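(* Let $n\geqslant 4$ and let $M$ be a $2\times 2$ Griffiths positive matrix of constant coefficient $(1,1)$-forms on $\mathbb{C}^n$ with diagonalized entries. Then $\Omega=\det(M)$ is a Lefschetz form for the bidegrees $(n-2,0)$, $(n-3,1)$, $(1,n-3)$ and $(0,n-2)$.
   Context: $V^{p,q}$ is the space of constant coefficient $(p,q)$-forms on $\mathbb{C}^n$. A $(1,1)$-form is Kähler if it equals $\sum_l\frac{\sqrt{-1}}{2}dw_l\wedge d\overline{w_l}$ in some complex linear coordinates. A matrix $M=(\alpha_{i,j})$ of $(1,1)$-forms with $\alpha_{i,j}=\overline{\alpha_{j,i}}$ is Griffiths positive if $\sum_{i,j}\theta_i\alpha_{i,j}\overline{\theta_j}$ is Kähler for every nonzero $\theta$. $M$ has diagonalized entries if in some complex linear coordinates $(z_l)$ every entry is $\sum_l b_{i,j}^{(l)}\frac{\sqrt{-1}}{2}dz_l\wedge d\overline{z_l}$. $\det(M)=\alpha_{1,1}\wedge\alpha_{2,2}-\alpha_{1,2}\wedge\alpha_{2,1}$. $\Omega\in V^{2,2}$ is a Lefschetz form for bidegree $(p,q)$, $p+q=n-2$, if $\alpha\mapsto\alpha\wedge\Omega$ is an isomorphism $V^{p,q}\to V^{n-q,n-p}$. *)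

theory Defs
  imports "HOL-Analysis.Analysis" "HOL-Library.Function_Algebras"
begin

text \<open>Constant coefficient forms on C^n, where n = CARD('n).
  The 2n basic one-forms are indexed by 'n + 'n: Inl j stands for dz_j and
  Inr j for d(conj z_j).  A form is the coefficient function on finite sets K
  of basic one-forms: the value at K is the coefficient of the wedge product of
  the elements of K taken in increasing order (order: all Inl before all Inr,
  each block ordered by the order of 'n).\<close>

type_synonym 'n form = "('n + 'n) set \<Rightarrow> complex"

fun olt :: "('n::linorder + 'n) \<Rightarrow> ('n + 'n) \<Rightarrow> bool" where
  "olt (Inl a) (Inl b) = (a < b)"
| "olt (Inl a) (Inr b) = True"
| "olt (Inr a) (Inl b) = False"
| "olt (Inr a) (Inr b) = (a < b)"

text \<open>Sign of e_A wedge e_B = sgn * e_(A union B) for disjoint A, B.\<close>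
definition wsign :: "('n::linorder + 'n) set \<Rightarrow> ('n + 'n) set \<Rightarrow> complex" where
  "wsign A B = (-1) ^ card {(a, b). a \<in> A \<and> b \<in> B \<and> olt b a}"

definition wedge :: "('n::{finite,linorder}) form \<Rightarrow> 'n form \<Rightarrow> 'n form" where
  "wedge \<alpha> \<beta> = (\<lambda>K. \<Sum>A | A \<subseteq> K. wsign A (K - A) * \<alpha> A * \<beta> (K - A))"

definition fscale :: "complex \<Rightarrow> ('n::{finite,linorder}) form \<Rightarrow> 'n form" where
  "fscale c \<alpha> = (\<lambda>K. c * \<alpha> K)"

definition hdeg :: "('n + 'n) set \<Rightarrow> nat" where "hdeg K = card (Inl -` K)"
definition adeg :: "('n + 'n) set \<Rightarrow> nat" where "adeg K = card (Inr -` K)"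

definition Vpq :: "nat \<Rightarrow> nat \<Rightarrow> ('n::{finite,linorder}) form set" where
  "Vpq p q = {\<alpha>. \<forall>K. \<alpha> K \<noteq> 0 \<longrightarrow> hdeg K = p \<and> adeg K = q}"

text \<open>Complex conjugation of forms: conj(dz_I ^ dzbar_J) = dzbar_I ^ dz_J
  = (-1)^(|I||J|) dz_J ^ dzbar_I.\<close>
definition fconj :: "('n::{finite,linorder}) form \<Rightarrow> 'n form" where
  "fconj \<alpha> = (\<lambda>K. (-1) ^ (hdeg K * adeg K) * cnj (\<alpha> (case_sum Inr Inl ` K)))"

definition dz :: "'n \<Rightarrow> ('n::{finite,linorder}) form" where
  "dz j = (\<lambda>K. if K = {Inl j} then 1 else 0)"
definition dzb :: "'n \<Rightarrow> ('n::{finite,linorder}) form" where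
  "dzb j = (\<lambda>K. if K = {Inr j} then 1 else 0)"

text \<open>For the complex linear coordinates w = A z (A invertible):
  dw_l = sum_j A_lj dz_j and d(conj w_l) = sum_j conj(A_lj) d(conj z_j).\<close>
definition dw :: "complex^('n::{finite,linorder})^('n::{finite,linorder}) \<Rightarrow> ('n::{finite,linorder}) \<Rightarrow> ('n::{finite,linorder}) form" where
  "dw A l = (\<Sum>j\<in>UNIV. fscale (A $ l $ j) (dz j))"
definition dwb :: "complex^('n::{finite,linorder})^('n::{finite,linorder}) \<Rightarrow> ('n::{finite,linorder}) \<Rightarrow> ('n::{finite,linorder}) form" where
  "dwb A l = (\<Sum>j\<in>UNIV. fscale (cnj (A $ l $ j)) (dzb j))"

definition std11 :: "complex^('n::{finite,linorder})^('n::{finite,linorder}) \<Rightarrow> ('n::{finite,linorder}) \<Rightarrow> ('n::{finite,linorder}) form" where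
  "std11 A l = fscale (\<i> / 2) (wedge (dw A l) (dwb A l))"

definition is_kahler :: "('n::{finite,linorder}) form \<Rightarrow> bool" where
  "is_kahler \<alpha> \<longleftrightarrow> (\<exists>A::complex^('n::{finite,linorder})^('n::{finite,linorder}). invertible A \<and> \<alpha> = (\<Sum>l\<in>UNIV. std11 A l))"

definition griffiths_positive :: "('n::{finite,linorder}) form^2^2 \<Rightarrow> bool" where
  "griffiths_positive M \<longleftrightarrow>
     (\<forall>i j. M $ i $ j \<in> Vpq 1 1) \<and>
     (\<forall>i j. M $ i $ j = fconj (M $ j $ i)) \<and>
     (\<forall>\<theta>::complex^2. \<theta> \<noteq> 0 \<longrightarrow>
        is_kahler (\<Sum>i\<in>UNIV. \<Sum>j\<in>UNIV. fscale (\<theta> $ i * cnj (\<theta> $ j)) (M $ i $ j)))"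

definition diagonalized_entries :: "('n::{finite,linorder}) form^2^2 \<Rightarrow> bool" where
  "diagonalized_entries M \<longleftrightarrow>
     (\<exists>A::complex^('n::{finite,linorder})^('n::{finite,linorder}). invertible A \<and>
        (\<exists>b :: 2 \<Rightarrow> 2 \<Rightarrow> 'n \<Rightarrow> complex.
           \<forall>i j. M $ i $ j = (\<Sum>l\<in>UNIV. fscale (b i j l) (std11 A l))))"

definition det2 :: "('n::{finite,linorder}) form^2^2 \<Rightarrow> 'n form" where
  "det2 M = wedge (M $ 1 $ 1) (M $ 2 $ 2) - wedge (M $ 1 $ 2) (M $ 2 $ 1)"

definition lefschetz :: "('n::{finite,linorder}) form \<Rightarrow> nat \<Rightarrow> nat \<Rightarrow> bool" where
  "lefschetz \<Omega> p q \<longleftrightarrow> \<Omega> \<in> Vpq 2 2 \<and> p + q = CARD('n) - 2 \<and>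
     bij_betw (\<lambda>\<alpha>. wedge \<alpha> \<Omega>) (Vpq p q) (Vpq (CARD('n) - q) (CARD('n) - p))"

end

(* In the diagonalizing coordinates, write omega_l = (i/2) dz_l dzbar_l.  Evaluating the Kaehler
   condition on coordinate vectors shows that M = sum_l B_l omega_l with positive definite Hermitian
   2x2 matrices B_l, so det M = sum_(l<m) c_lm omega_l omega_m, where c_lm = 2 D(B_l, B_m) > 0 is the
   polarization of twice the determinant.

   Multiplication by det M respects torus weights.  In the four bidegrees a weight space is either a line,
   where the map is multiplication by some c_lm, or it has a basis dz_P dzbar_R omega_j with j in a
   4-element set S.  In the second case the matrix is (c_(S - {j,k})) with zero diagonal, whose
   determinant is x^2 + y^2 + z^2 - 2xy - 2yz - 2xz for x = c_12 c_34, y = c_13 c_24,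
   z = c_14 c_23.  This is also the determinant of the zero-diagonal matrix C = (c_lm).  If C v = 0,
   then X = sum_m v_m B_m satisfies <B_l, X> = <B_l, B_l> v_l, and the reversed Cauchy-Schwarz
   inequality of the Lorentzian form gives <B_l, B_l> v_l^2 >= <X, X> = sum_m <B_m, B_m> v_m^2
   for every l, so that v = 0. *)

theory Submission
  imports Defs
begin

section \<open>The determinant form on Hermitian 2x2 matrices\<close>

text \<open>Subtracting \<open>k = p' / p\<close> times the first Hermitian matrix from the second
  annihilates the upper left entry, so the difference has determinant at most 0. That determinant is
  \<open>Q - k * c + k\<^sup>2 * q\<close>; completing the square in \<open>k\<close> then bounds
  \<open>4 * q * Q\<close> by \<open>c\<^sup>2\<close>.\<close>

lemma reverse_cauchy_schwarz:
  fixes p r s t p' r' s' t' :: real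
  assumes "p \<noteq> 0"  "p * r > s\<^sup>2 + t\<^sup>2"
  shows "4 * (p * r - s\<^sup>2 - t\<^sup>2) * (p' * r' - s'\<^sup>2 - t'\<^sup>2) \<le> (p * r' + p' * r - 2 * s * s' - 2 * t * t')\<^sup>2"
proof -
  define k q Q c where "k = p' / p" and "q = p * r - s\<^sup>2 - t\<^sup>2" and "Q = p' * r' - s'\<^sup>2 - t'\<^sup>2"
    and "c = p * r' + p' * r - 2 * s * s' - 2 * t * t'"
  have p': "p' = k * p" using assms by (simp add: k_def)
  have "Q - k * c + k\<^sup>2 * q = - (s' - k * s)\<^sup>2 - (t' - k * t)\<^sup>2"
    unfolding p' q_def Q_def c_def by (simp add: power2_eq_square algebra_simps)
  then have "Q \<le> k * c - k\<^sup>2 * q" by (smt (verit) zero_le_power2)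
  then have "4 * q * Q \<le> 4 * q * (k * c - k\<^sup>2 * q)"
    using assms by (intro mult_left_mono) (auto simp: q_def)
  also have "\<dots> = c\<^sup>2 - (c - 2 * k * q)\<^sup>2"
    by (simp add: power2_eq_square algebra_simps)
  also have "\<dots> \<le> c\<^sup>2" by simp
  finally show ?thesis by (simp add: q_def Q_def c_def)
qed

text \<open>The tuple (p, r, s, t) stands for the Hermitian matrix with diagonal entries p, r and upper right
  entry s + it.  The form below is the polarization of twice the determinant, which has
  signature (1,3) on Hermitian matrices.\<close>

definition herm_form :: "(real \<times> real \<times> real \<times> real) \<Rightarrow> (real \<times> real \<times> real \<times> real) \<Rightarrow> real" where
  "herm_form = (\<lambda>(p, r, s, t) (p', r', s', t'). p * r' + p' * r - 2 * s * s' - 2 * t * t')"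

lemma herm_form_commute: "herm_form x y = herm_form y x"
  by (cases x; cases y) (simp add: herm_form_def)

lemma herm_form_cauchy_schwarz:
  assumes "fst x > 0" "herm_form x x > 0"
  shows "herm_form x x * herm_form y y \<le> (herm_form x y)\<^sup>2"
proof -
  obtain p r s t p' r' s' t' where xy: "x = (p, r, s, t)" "y = (p', r', s', t')" 
    by (metis surj_pair)
  show ?thesis
    using assms reverse_cauchy_schwarz[of p s t r p' r' s' t']
    by (simp add: xy herm_form_def power2_eq_square algebra_simps)
qed

text \<open>Two vectors in the same open light cone pair positively: multiplied by
  \<open>p * p'\<close>, the form becomes a positive combination of the two determinants plus two
  squares.\<close>

lemma herm_form_pos:
  assumes "fst x > 0" "herm_form x x > 0" "fst y > 0" "herm_form y y > 0"
  shows "herm_form x y > 0"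
proof -
  obtain p r s t p' r' s' t' where xy: "x = (p, r, s, t)" "y = (p', r', s', t')" 
    by (metis surj_pair)
  have 0: "p > 0" "p' > 0" "p * r > s\<^sup>2 + t\<^sup>2" "p' * r' > s'\<^sup>2 + t'\<^sup>2"
    using assms by (auto simp: xy herm_form_def power2_eq_square algebra_simps)
  have "p * p' * herm_form x y = p'\<^sup>2 * (p * r - s\<^sup>2 - t\<^sup>2) + p\<^sup>2 * (p' * r' - s'\<^sup>2 - t'\<^sup>2)
     + (p' * s - p * s')\<^sup>2 + (p' * t - p * t')\<^sup>2"
    by (simp add: xy herm_form_def power2_eq_square algebra_simps)
  also have "\<dots> > 0" using 0 by (intro add_pos_nonneg add_pos_pos mult_pos_pos) auto
  finally show ?thesis using 0 by (meson mult_pos_pos zero_less_mult_pos)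
qed

text \<open>The expression is the determinant of the 4x4 matrix of pairings with its diagonal
  replaced by zero. If it vanished, a kernel vector \<open>v\<close> with \<open>v 0 > 0\<close>
  would give a combination \<open>X\<close> of the \<open>B i\<close> that contradicts the reversed
  Cauchy-Schwarz inequality.\<close>

lemma herm_form_zero_diagonal_det:
  fixes B :: "nat \<Rightarrow> real \<times> real \<times> real \<times> real"
  assumes pos: "\<And>i. fst (B i) > 0 \<and> herm_form (B i) (B i) > 0"
  defines "x \<equiv> herm_form (B 0) (B 1) * herm_form (B 2) (B 3)"
    and "y \<equiv> herm_form (B 0) (B 2) * herm_form (B 1) (B 3)"
    and "z \<equiv> herm_form (B 0) (B 3) * herm_form (B 1) (B 2)"
  shows "x\<^sup>2 + y\<^sup>2 + z\<^sup>2 - 2 * x * y - 2 * y * z - 2 * x * z \<noteq> 0"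
proof
  assume 0: "x\<^sup>2 + y\<^sup>2 + z\<^sup>2 - 2 * x * y - 2 * y * z - 2 * x * z = 0"
  define c where "c i j = herm_form (B i) (B j)" for i j
  have sym: "c j i = c i j" for i j by (simp add: c_def herm_form_commute)
  have xyz: "x = c 0 1 * c 2 3" "y = c 0 2 * c 1 3" "z = c 0 3 * c 1 2"
    by (simp_all add: c_def x_def y_def z_def)
  define v :: "nat \<Rightarrow> real" where
    "v = (\<lambda>i. [2 * c 1 2 * c 1 3 * c 2 3, c 2 3 * (x - y - z), c 1 3 * (y - x - z), c 1 2 * (z - x - y)] ! i)"
  define X where "X = ((\<Sum>i<4. v i * fst (B i)), (\<Sum>i<4. v i * fst (snd (B i))),
    (\<Sum>i<4. v i * fst (snd (snd (B i)))), (\<Sum>i<4. v i * snd (snd (snd (B i)))))"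
  have form_X: "herm_form Y X = (\<Sum>j<4. v j * herm_form Y (B j))" for Y
    unfolding X_def herm_form_def by (simp add: split_beta numeral_eq_Suc algebra_simps)
  have v: "v 0 = 2 * c 1 2 * c 1 3 * c 2 3" "v 1 = c 2 3 * (x - y - z)"
    "v 2 = c 1 3 * (y - x - z)" "v 3 = c 1 2 * (z - x - y)"
    by (simp_all add: v_def numeral_eq_Suc)
  have sum4: "(\<Sum>j<4. f j) = f 0 + f 1 + f 2 + f 3" for f :: "nat \<Rightarrow> real"
    by (simp add: numeral_eq_Suc)
  \<comment> \<open>v is the first column of the adjugate of the zero-diagonal matrix c, whose determinant vanishes by 0.\<close>
  have r0: "v 1 * c 0 1 + v 2 * c 0 2 + v 3 * c 0 3 = 0"
    using 0 unfolding v xyz by (simp add: power2_eq_square algebra_simps)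
  have r1: "v 0 * c 0 1 + v 2 * c 1 2 + v 3 * c 1 3 = 0"
    unfolding v xyz by (simp add: algebra_simps)
  have r2: "v 0 * c 0 2 + v 1 * c 1 2 + v 3 * c 2 3 = 0"
    unfolding v xyz by (simp add: algebra_simps)
  have r3: "v 0 * c 0 3 + v 1 * c 1 3 + v 2 * c 2 3 = 0"
    unfolding v xyz by (simp add: algebra_simps)
  \<comment> \<open>The four row relations cancel all off-diagonal contributions to the pairing of
    \<open>B i\<close> with \<open>X\<close>; only the diagonal one survives.\<close>
  have d: "herm_form (B i) X = v i * c i i" if "i < 4" for i
  proof -
    have "i = 0 \<or> i = 1 \<or> i = 2 \<or> i = 3" using that by auto
    then show ?thesis
      unfolding form_X sum4 c_def [symmetric]
      using r0 r1 r2 r3 sym[of 1 0] sym[of 2 0] sym[of 3 0] sym[of 2 1] sym[of 3 1] sym[of 3 2]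
      by (elim disjE) (simp_all add: algebra_simps)
  qed
  define S where "S = (\<Sum>i<4. (v i)\<^sup>2 * c i i)"
  have XX: "herm_form X X = S"
  proof -
    have "herm_form X X = (\<Sum>j<4. v j * herm_form (B j) X)" unfolding form_X[of X] by (simp add: herm_form_commute)
    also have "\<dots> = S" unfolding S_def by (intro sum.cong) (auto simp: d power2_eq_square)
    finally show ?thesis .
  qed
  have cpos: "c i i > 0" for i using pos by (simp add: c_def)
  have "S \<le> (v i)\<^sup>2 * c i i" if "i < 4" for i
  proof -
    have "c i i * S \<le> (v i * c i i)\<^sup>2"
      using herm_form_cauchy_schwarz[of "B i" X] pos[of i] d[OF that] by (simp add: XX c_def)
    then have "c i i * S \<le> c i i * ((v i)\<^sup>2 * c i i)" by (simp add: power2_eq_square mult_ac)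
    then show ?thesis using cpos[of i] by simp
  qed
  \<comment> \<open>Each of the four summands of \<open>S\<close> is at least \<open>S\<close>, so
    \<open>4 * S \<le> S\<close>, whereas \<open>v 0 > 0\<close> makes \<open>S\<close>
    positive.\<close>
  then have "(\<Sum>i<(4::nat). S) \<le> S" unfolding S_def by (intro sum_mono) auto
  then have "S \<le> 0" by simp
  moreover have "S \<ge> (v 0)\<^sup>2 * c 0 0"
    unfolding S_def sum4 using cpos by (simp add: less_imp_le)
  moreover have "v 0 > 0"
    using herm_form_pos pos by (simp add: v c_def)
  ultimately show False using cpos[of 0] by (smt (verit) mult_pos_pos zero_less_power)
qed

text \<open>Cramer's rule for the symmetric zero-diagonal matrix whose entry at two indices is the
  coefficient of the complementary pair. Its determinant is the expression in \<open>d\<close>, so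
  the cofactors combine the four equations into determinant times \<open>u0\<close> equals
  0.\<close>

lemma zero_diagonal_kernel4:
  fixes u0 u1 u2 u3 c01 c02 c03 c12 c13 c23 :: complex
  defines "x \<equiv> c01 * c23" and "y \<equiv> c02 * c13" and "z \<equiv> c03 * c12"
  assumes d: "x\<^sup>2 + y\<^sup>2 + z\<^sup>2 - 2 * x * y - 2 * y * z - 2 * x * z \<noteq> 0"
    and e: "u1 * c23 + u2 * c13 + u3 * c12 = 0"  "u0 * c23 + u2 * c03 + u3 * c02 = 0"
     "u0 * c13 + u1 * c03 + u3 * c01 = 0"  "u0 * c12 + u1 * c02 + u2 * c01 = 0"
  shows "u0 = 0"
proof -
  have "(x\<^sup>2 + y\<^sup>2 + z\<^sup>2 - 2 * x * y - 2 * y * z - 2 * x * z) * u0 = 0"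
    using e unfolding x_def y_def z_def by algebra
  with d show ?thesis by simp
qed

section \<open>The exterior algebra\<close>

lemma sum_form_apply: "(\<Sum>x\<in>S. f x :: 'b \<Rightarrow> complex) K = (\<Sum>x\<in>S. f x K)"
  by (induction S rule: infinite_finite_induct) auto

definition basis_form :: "('n + 'n) set \<Rightarrow> ('n::{finite,linorder}) form" where
  "basis_form K = (\<lambda>L. if L = K then 1 else 0)"

lemma fscale_apply: "fscale c \<alpha> K = c * \<alpha> K"
  by (simp add: fscale_def)

lemma form_expand: "(\<Sum>K\<in>UNIV. fscale (\<alpha> K) (basis_form K)) = \<alpha>"
  by (rule ext) (simp add: sum_form_apply fscale_def basis_form_def if_distrib [of "\<lambda>x. _ * x"] cong: if_cong)

text \<open>The monomials are a finite basis of the space of forms. This gives access to linear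
  algebra, in particular to the fact that an injective endomorphism is surjective.\<close>

interpretation form: finite_dimensional_vector_space fscale "range basis_form"
proof unfold_locales
  interpret vector_space "fscale :: complex \<Rightarrow> 'n::{finite,linorder} form \<Rightarrow> 'n form"
    by unfold_locales (auto simp: fscale_def fun_eq_iff algebra_simps)
  have inj: "inj (basis_form :: ('n + 'n) set \<Rightarrow> 'n form)"
    by (rule injI) (metis basis_form_def zero_neq_one)
  show "independent (range (basis_form :: ('n + 'n) set \<Rightarrow> 'n form))"
  proof (rule independent_if_scalars_zero)
    fix f :: "'n form \<Rightarrow> complex" and x :: "'n form"
    assume 0: "(\<Sum>x\<in>range basis_form. fscale (f x) x) = 0" and "x \<in> range basis_form"
    then obtain K where x: "x = basis_form K" by auto
    have "(\<Sum>L\<in>UNIV. fscale (f (basis_form L)) (basis_form L)) K = f (basis_form K)"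
      using form_expand [of "\<lambda>L. f (basis_form L)"] by simp
    with 0 show "f x = 0" by (simp add: sum.reindex [OF inj] x)
  qed simp
  show "span (range (basis_form :: ('n + 'n) set \<Rightarrow> 'n form)) = UNIV"
    by (metis (no_types, lifting) UNIV_eq_I form_expand rangeI span_base span_scale span_sum)
qed (auto simp: fscale_def fun_eq_iff algebra_simps)

interpretation form2: vector_space_pair fscale fscale ..

abbreviation flin :: "(('n::{finite,linorder}) form \<Rightarrow> 'n form) \<Rightarrow> bool" where
  "flin \<equiv> Vector_Spaces.linear fscale fscale"

lemma flinI:
  assumes "\<And>\<alpha> \<beta>. f (\<alpha> + \<beta>) = f \<alpha> + f \<beta>" "\<And>c \<alpha>. f (fscale c \<alpha>) = fscale c (f \<alpha>)"
  shows "flin f"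
  using assms by (simp add: Vector_Spaces.linear_iff form.vector_space_axioms)

lemma flin_sum: "flin f \<Longrightarrow> f (\<Sum>x\<in>S. g x) = (\<Sum>x\<in>S. f (g x))"
  by (rule form2.linear_sum)

lemma flin_scale: "flin f \<Longrightarrow> f (fscale c \<alpha>) = fscale c (f \<alpha>)"
  by (rule form2.linear_scale)

lemma flin_eqI:
  assumes "flin f" "flin g" "\<And>K. f (basis_form K) = g (basis_form K)"
  shows "f \<alpha> = g \<alpha>"
proof -
  have "f (\<Sum>K\<in>UNIV. fscale (\<alpha> K) (basis_form K)) = g (\<Sum>K\<in>UNIV. fscale (\<alpha> K) (basis_form K))"
    using assms by (simp add: flin_sum flin_scale)
  then show ?thesis by (simp only: form_expand)
qed

lemma flin_wedge_left: "flin (\<lambda>\<alpha>. wedge \<alpha> \<beta>)"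
  by (rule flinI)
     (simp_all add: wedge_def fscale_def fun_eq_iff sum.distrib sum_distrib_left algebra_simps)

lemma flin_wedge_right: "flin (wedge \<alpha>)"
  by (rule flinI)
     (simp_all add: wedge_def fscale_def fun_eq_iff sum.distrib sum_distrib_left algebra_simps)

lemma flin_comp: "flin f \<Longrightarrow> flin g \<Longrightarrow> flin (\<lambda>\<alpha>. f (g \<alpha>))"
  using Vector_Spaces.linear_compose [of fscale fscale g fscale f] by (simp add: o_def)

lemmas wedge_simps =
  flin_scale [OF flin_wedge_left] flin_scale [OF flin_wedge_right]
  form2.linear_0 [OF flin_wedge_left] form2.linear_0 [OF flin_wedge_right]
  form2.linear_neg [OF flin_wedge_left] form2.linear_neg [OF flin_wedge_right]

section \<open>Products of monomials and their signs\<close>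

lemma wedge_basis_form_right:
  "wedge \<alpha> (basis_form B) K = (if B \<subseteq> K then wsign (K - B) B * \<alpha> (K - B) else 0)"
proof -
  have "wedge \<alpha> (basis_form B) K = (\<Sum>A | A \<subseteq> K. if A = K - B \<and> B \<subseteq> K then wsign (K - B) B * \<alpha> (K - B) else 0)"
    unfolding wedge_def basis_form_def by (intro sum.cong) (auto simp: double_diff)
  also have "\<dots> = (if B \<subseteq> K then wsign (K - B) B * \<alpha> (K - B) else 0)"
    by (cases "B \<subseteq> K") (auto simp: sum.delta)
  finally show ?thesis .
qed

lemma wedge_basis_form:
  "wedge (basis_form A) (basis_form B) = (if A \<inter> B = {} then fscale (wsign A B) (basis_form (A \<union> B)) else 0)"
proof (rule ext)
  fix K
  have "wedge (basis_form A) (basis_form B) K = (if B \<subseteq> K \<and> K - B = A then wsign A B else 0)"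
    unfolding wedge_basis_form_right by (simp add: basis_form_def)
  moreover have "B \<subseteq> K \<and> K - B = A \<longleftrightarrow> A \<inter> B = {} \<and> K = A \<union> B" by auto
  ultimately show "wedge (basis_form A) (basis_form B) K =
      (if A \<inter> B = {} then fscale (wsign A B) (basis_form (A \<union> B)) else 0) K"
    by (simp add: fscale_def basis_form_def)
qed

lemma wsign_empty [simp]: "wsign {} B = 1" "wsign A {} = 1"
  by (auto simp: wsign_def)

text \<open>The exponent in \<open>wsign\<close> counts inversions, and the inversions of a disjoint
  union split into those of its two parts.\<close>

lemma wsign_Un_left:
  fixes A B C :: "('n::{finite,linorder} + 'n) set"
  assumes "A \<inter> B = {}"
  shows "wsign (A \<union> B) C = wsign A C * wsign B C"
proof -
  have "{(a, b). a \<in> A \<union> B \<and> b \<in> C \<and> olt b a}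
      = {(a, b). a \<in> A \<and> b \<in> C \<and> olt b a} \<union> {(a, b). a \<in> B \<and> b \<in> C \<and> olt b a}"
    by auto
  moreover have "{(a, b). a \<in> A \<and> b \<in> C \<and> olt b a} \<inter> {(a, b). a \<in> B \<and> b \<in> C \<and> olt b a} = {}"
    using assms by auto
  ultimately show ?thesis
    unfolding wsign_def by (simp add: card_Un_disjoint power_add)
qed

lemma wsign_Un_right:
  fixes A B C :: "('n::{finite,linorder} + 'n) set"
  assumes "B \<inter> C = {}"
  shows "wsign A (B \<union> C) = wsign A B * wsign A C"
proof -
  have "{(a, b). a \<in> A \<and> b \<in> B \<union> C \<and> olt b a}
      = {(a, b). a \<in> A \<and> b \<in> B \<and> olt b a} \<union> {(a, b). a \<in> A \<and> b \<in> C \<and> olt b a}"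
    by auto
  moreover have "{(a, b). a \<in> A \<and> b \<in> B \<and> olt b a} \<inter> {(a, b). a \<in> A \<and> b \<in> C \<and> olt b a} = {}"
    using assms by auto
  ultimately show ?thesis
    unfolding wsign_def by (simp add: card_Un_disjoint power_add)
qed

text \<open>On monomials both sides carry the product of the three pairwise signs, or vanish when
  two index sets meet. Linearity then frees the three arguments one after the other.\<close>

lemma wedge_assoc: "wedge (wedge \<alpha> \<beta>) \<gamma> = wedge \<alpha> (wedge \<beta> \<gamma>)"
proof -
  have 1: "wedge (wedge (basis_form A) (basis_form B)) (basis_form C) = wedge (basis_form A) (wedge (basis_form B) (basis_form C))"
    for A B C :: "('a + 'a) set"
  proof (cases "A \<inter> B = {} \<and> A \<inter> C = {} \<and> B \<inter> C = {}")
    case True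
    then show ?thesis
      by (simp add: wedge_basis_form wedge_simps wsign_Un_left wsign_Un_right Int_Un_distrib
          Int_Un_distrib2 Un_assoc mult_ac)
  next
    case False
    then show ?thesis
      by (auto simp: wedge_basis_form wedge_simps Int_Un_distrib Int_Un_distrib2)
  qed
  have 2: "wedge (wedge (basis_form A) (basis_form B)) \<gamma> = wedge (basis_form A) (wedge (basis_form B) \<gamma>)" for A B
    by (rule flin_eqI [OF flin_wedge_right flin_comp [OF flin_wedge_right flin_wedge_right] 1])
  have 3: "wedge (wedge (basis_form A) \<beta>) \<gamma> = wedge (basis_form A) (wedge \<beta> \<gamma>)" for A
    by (rule flin_eqI [OF flin_comp [OF flin_wedge_left flin_wedge_right]
          flin_comp [OF flin_wedge_right flin_wedge_left] 2])
  show ?thesis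
    by (rule flin_eqI [OF flin_comp [OF flin_wedge_left flin_wedge_left] flin_wedge_left 3])
qed

lemma olt_total: "a \<noteq> b \<Longrightarrow> olt a b \<longleftrightarrow> \<not> olt b a"
  by (cases a; cases b) auto

lemma olt_irrefl [simp]: "\<not> olt a a"
  by (cases a) auto

lemma wsign_singletons: "wsign {a} {b} = (if olt b a then -1 else 1)"
proof -
  have "{(x, y). x \<in> {a} \<and> y \<in> {b} \<and> olt y x} = (if olt b a then {(a, b)} else {})" by auto
  then show ?thesis by (simp add: wsign_def)
qed

lemma wedge_one_left: "wedge (basis_form {}) \<alpha> = \<alpha>"
  by (rule flin_eqI [of "wedge (basis_form {})"])
     (auto simp: flin_wedge_right wedge_basis_form form.linear_ident)

lemma wedge_basis_form_singletons_anti: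
  "wedge (basis_form {a}) (basis_form {b}) = - wedge (basis_form {b}) (basis_form {a})"
  using olt_total [of a b]
  by (cases "a = b") (auto simp: wedge_basis_form wsign_singletons insert_commute)

text \<open>The least element for \<open>olt\<close>: the \<open>Inr\<close> block is consulted only
  when the \<open>Inl\<close> block is empty.\<close>

definition omin :: "('n::{finite,linorder} + 'n) set \<Rightarrow> 'n + 'n" where
  "omin K = (if Inl -` K = {} then Inr (Min (Inr -` K)) else Inl (Min (Inl -` K)))"

lemma omin_in: "K \<noteq> {} \<Longrightarrow> omin K \<in> K"
proof -
  assume "K \<noteq> {}"
  then obtain k where "k \<in> K" by auto
  then show ?thesis
    using Min_in [of "Inl -` K"] Min_in [of "Inr -` K"]
    by (cases k) (auto simp: omin_def)
qed

lemma omin_less: "k \<in> K \<Longrightarrow> \<not> olt k (omin K)"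
  by (cases k) (auto simp: omin_def not_less)

lemma omin_eqI:
  assumes "m \<in> K" "\<And>k. k \<in> K \<Longrightarrow> \<not> olt k m"
  shows "omin K = m"
  using assms olt_total [of m "omin K"] omin_in [of K] omin_less [of m K] by blast

section \<open>Substitution of one-forms\<close>

lemma olt_trans: "olt a b \<Longrightarrow> olt b c \<Longrightarrow> olt a c"
  by (cases a; cases b; cases c) auto

lemma wedge_one_right: "wedge \<alpha> (basis_form {}) = \<alpha>"
  by (rule flin_eqI [of "\<lambda>\<alpha>. wedge \<alpha> (basis_form {})"])
     (auto simp: flin_wedge_left wedge_basis_form form.linear_ident)

text \<open>The wedge product of the one-forms \<open>x k\<close> in increasing order of
  \<open>k\<close>, that is, the image of the monomial of \<open>K\<close> when each basic one-form
  is replaced by \<open>x k\<close>.\<close>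

function ordprod :: "('n::{finite,linorder} + 'n \<Rightarrow> 'n form) \<Rightarrow> ('n + 'n) set \<Rightarrow> 'n form" where
  "ordprod x K = (if K = {} then basis_form {} else wedge (x (omin K)) (ordprod x (K - {omin K})))"
  by auto
termination
  by (relation "Wellfounded.measure (\<lambda>(x, K). card K)") (simp_all add: card_gt_0_iff omin_in)

declare ordprod.simps [simp del]

lemma olt_asym: "olt a b \<Longrightarrow> \<not> olt b a"
  by (cases a; cases b) auto

lemma omin_insert: "(\<And>k. k \<in> K \<Longrightarrow> olt m k) \<Longrightarrow> omin (insert m K) = m"
  by (rule omin_eqI) (auto dest: olt_asym)

text \<open>Elements are added from the largest down, so each new one is the least. This matches the
  recursion of \<open>ordprod\<close>, which splits off the least factor.\<close>

lemma olt_induct [case_names empty insert]: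
  fixes K :: "('n::{finite,linorder} + 'n) set"
  assumes "P {}"
    and "\<And>m K. m \<notin> K \<Longrightarrow> (\<And>k. k \<in> K \<Longrightarrow> olt m k) \<Longrightarrow> P K \<Longrightarrow> P (insert m K)"
  shows "P K"
proof (induction "card K" arbitrary: K)
  case 0
  then show ?case using assms(1) by simp
next
  case (Suc n)
  then have "K \<noteq> {}" by auto
  then have m: "omin K \<in> K" by (rule omin_in)
  have "P (insert (omin K) (K - {omin K}))"
  proof (rule assms(2))
    show "olt (omin K) k" if "k \<in> K - {omin K}" for k
      using that olt_total [of "omin K" k] omin_less [of k K] by auto
    show "P (K - {omin K})"
      using Suc m by (intro Suc.hyps(1)) auto
  qed auto
  then show ?case using m by (simp add: insert_absorb)
qed

lemma ordprod_empty [simp]: "ordprod x {} = basis_form {}"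
  by (subst ordprod.simps) simp

lemma ordprod_insert:
  "m \<notin> K \<Longrightarrow> (\<And>k. k \<in> K \<Longrightarrow> olt m k) \<Longrightarrow> ordprod x (insert m K) = wedge (x m) (ordprod x K)"
  by (subst ordprod.simps) (simp add: omin_insert)

lemma ordprod_singleton [simp]: "ordprod x {j} = x j"
  using ordprod_insert [of j "{}" x] by (simp add: wedge_one_right)

lemma wsign_insert_right:
  fixes A K :: "('n::{finite,linorder} + 'n) set"
  shows "m \<notin> K \<Longrightarrow> wsign A (insert m K) = wsign A {m} * wsign A K"
  using wsign_Un_right [of "{m}" K A] by simp

lemma wsign_eq_1: "(\<And>a b. a \<in> A \<Longrightarrow> b \<in> B \<Longrightarrow> \<not> olt b a) \<Longrightarrow> wsign A B = 1"
proof -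
  assume "\<And>a b. a \<in> A \<Longrightarrow> b \<in> B \<Longrightarrow> \<not> olt b a"
  then have "{(a, b). a \<in> A \<and> b \<in> B \<and> olt b a} = {}" by auto
  then show ?thesis unfolding wsign_def by (simp only: card.empty power_0)
qed

lemma basis_form_insert:
  assumes "m \<notin> K" "\<And>k. k \<in> K \<Longrightarrow> olt m k"
  shows "basis_form (insert m K) = wedge (basis_form {m}) (basis_form K)"
proof -
  have "wsign {m} K = 1" using assms by (intro wsign_eq_1) (auto dest: olt_asym)
  then show ?thesis using assms by (simp add: wedge_basis_form)
qed

text \<open>The condition under which replacing basic one-forms by \<open>x\<close> respects wedge
  products. The case \<open>i = j\<close> makes every square vanish, since a form equal to its
  negative is 0.\<close>

definition anticomm :: "('n::{finite,linorder} + 'n \<Rightarrow> 'n form) \<Rightarrow> bool" where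
  "anticomm x \<longleftrightarrow> (\<forall>i j. wedge (x i) (x j) = - wedge (x j) (x i))"

lemma form_eq_uminus: "(\<alpha> :: ('n::{finite,linorder}) form) = - \<alpha> \<Longrightarrow> \<alpha> = 0"
proof (rule ext)
  fix K
  assume "\<alpha> = - \<alpha>"
  from fun_cong [OF this, of K] have "2 * \<alpha> K = 0" by (simp add: eq_neg_iff_add_eq_0)
  then show "\<alpha> K = 0 K" by simp
qed

text \<open>Moving \<open>x j\<close> to its place costs one sign for each smaller element of
  \<open>K\<close>, which is what \<open>wsign {j} K\<close> counts; if \<open>j\<close> already
  occurs, a square appears and the product is 0.\<close>

lemma wedge_ordprod:
  assumes "anticomm x"
  shows "wedge (x j) (ordprod x K) = (if j \<in> K then 0 else fscale (wsign {j} K) (ordprod x (insert j K)))"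
proof (induction K rule: olt_induct)
  case empty
  then show ?case by (simp add: wedge_one_right)
next
  case (insert m K)
  have anti: "wedge (x i) (x j) = - wedge (x j) (x i)" for i j
    using assms unfolding anticomm_def by blast
  have nil: "wedge (x i) (x i) = 0" for i
    using anti [of i i] by (rule form_eq_uminus)
  have swap: "wedge (x j) (ordprod x (insert m K)) = - wedge (x m) (wedge (x j) (ordprod x K))"
  proof -
    have "wedge (x j) (ordprod x (insert m K)) = wedge (wedge (x j) (x m)) (ordprod x K)"
      by (simp only: ordprod_insert [OF insert.hyps] wedge_assoc)
    also have "\<dots> = - wedge (x m) (wedge (x j) (ordprod x K))"
      by (simp only: anti [of j m] form2.linear_neg [OF flin_wedge_left] wedge_assoc)
    finally show ?thesis .
  qed
  consider "j = m" | "j \<in> K" "j \<noteq> m" | "j \<notin> K" "j \<noteq> m" "olt j m" | "j \<notin> K" "j \<noteq> m" "olt m j"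
    using olt_total [of j m] by blast
  then show ?case
  proof cases
    case 1
    then show ?thesis
      by (simp add: ordprod_insert [OF insert.hyps] wedge_assoc [symmetric] nil wedge_simps)
  next
    case 2
    then show ?thesis unfolding swap insert.IH by (simp add: wedge_simps)
  next
    case 3
    then have less: "olt j k" if "k \<in> insert m K" for k
      using that insert.hyps olt_trans [of j m k] by auto
    then have "wsign {j} (insert m K) = 1"
      by (intro wsign_eq_1) (auto dest: olt_asym)
    moreover have "ordprod x (insert j (insert m K)) = wedge (x j) (ordprod x (insert m K))"
      using 3 less by (intro ordprod_insert) auto
    ultimately show ?thesis using 3 by simp
  next
    case 4
    have "wsign {j} (insert m K) = - wsign {j} K"
      using insert.hyps 4 by (simp add: wsign_insert_right wsign_singletons)
    moreover have "ordprod x (insert m (insert j K)) = wedge (x m) (ordprod x (insert j K))"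
      using 4 insert.hyps by (intro ordprod_insert) auto
    ultimately show ?thesis
      using 4 unfolding swap insert.IH by (simp add: wedge_simps insert_commute [of j m])
  qed
qed

text \<open>The linear extension of \<open>ordprod x\<close> from monomials to forms. With
  \<open>x = coord A\<close> it is the pullback along the coordinate change
  \<open>w = A z\<close>.\<close>

definition subst_form :: "('n::{finite,linorder} + 'n \<Rightarrow> 'n form) \<Rightarrow> 'n form \<Rightarrow> 'n form" where
  "subst_form x \<alpha> = (\<Sum>K\<in>UNIV. fscale (\<alpha> K) (ordprod x K))"

lemma flin_subst_form: "flin (subst_form x)"
  by (rule flinI)
     (simp_all add: subst_form_def fscale_apply form.scale_left_distrib sum.distrib form.scale_sum_right)

lemma subst_form_basis_form: "subst_form x (basis_form K) = ordprod x K"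
proof -
  have "subst_form x (basis_form K) = (\<Sum>L\<in>UNIV. if L = K then ordprod x K else 0)"
    unfolding subst_form_def by (intro sum.cong) (auto simp: basis_form_def)
  then show ?thesis by simp
qed

text \<open>The universal property of the exterior algebra. For a left factor of degree one it is
  \<open>wedge_ordprod\<close>; a left monomial is a product of such factors by associativity, and
  linearity gives the general case.\<close>

lemma subst_form_wedge:
  assumes "anticomm x"
  shows "subst_form x (wedge \<alpha> \<beta>) = wedge (subst_form x \<alpha>) (subst_form x \<beta>)"
proof -
  have 1: "subst_form x (wedge (basis_form {j}) (basis_form K)) = wedge (x j) (subst_form x (basis_form K))" for j K
    by (simp add: subst_form_basis_form wedge_basis_form wedge_ordprod [OF assms] flin_scale [OF flin_subst_form]
        form2.linear_0 [OF flin_subst_form])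
  have 2: "subst_form x (wedge (basis_form {j}) \<beta>) = wedge (x j) (subst_form x \<beta>)" for j \<beta>
    by (rule flin_eqI [OF flin_comp [OF flin_subst_form flin_wedge_right]
          flin_comp [OF flin_wedge_right flin_subst_form] 1])
  have 3: "subst_form x (wedge (basis_form K) \<beta>) = wedge (subst_form x (basis_form K)) (subst_form x \<beta>)" for K \<beta>
  proof (induction K arbitrary: \<beta> rule: olt_induct)
    case empty
    then show ?case by (simp add: wedge_one_left subst_form_basis_form)
  next
    case (insert m K)
    then show ?case by (simp add: basis_form_insert [OF insert.hyps] wedge_assoc 2)
  qed
  show ?thesis
    by (rule flin_eqI [OF flin_comp [OF flin_subst_form flin_wedge_left]
          flin_comp [OF flin_wedge_left flin_subst_form] 3])
qed

text \<open>The composite maps each basic one-form to itself, and multiplicativity carries this to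
  ordered products, hence to all forms.\<close>

lemma subst_form_inverse:
  assumes "anticomm x" "\<And>j. subst_form x (y j) = basis_form {j}"
  shows "subst_form x (subst_form y \<alpha>) = \<alpha>"
proof (rule flin_eqI [OF flin_comp [OF flin_subst_form flin_subst_form] form.linear_ident])
  fix K
  have "subst_form x (ordprod y K) = basis_form K"
  proof (induction K rule: olt_induct)
    case empty
    show ?case unfolding ordprod_empty subst_form_basis_form ..
  next
    case (insert m K)
    show ?case
      by (simp only: ordprod_insert [OF insert.hyps] basis_form_insert [OF insert.hyps]
          subst_form_wedge [OF assms(1)] assms(2) insert.IH)
  qed
  then show "subst_form x (subst_form y (basis_form K)) = basis_form K"
    by (simp only: subst_form_basis_form)
qed

section \<open>Linear changes of coordinates\<close>

definition coord :: "complex^('n::{finite,linorder})^('n::{finite,linorder}) \<Rightarrow> ('n::{finite,linorder}) + 'n \<Rightarrow> 'n form" where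
  "coord A = case_sum (dw A) (dwb A)"

lemma dw_basis_form: "dw A l = (\<Sum>j\<in>UNIV. fscale (A $ l $ j) (basis_form {Inl j}))"
  by (simp add: dw_def dz_def basis_form_def)

lemma dwb_basis_form: "dwb A l = (\<Sum>j\<in>UNIV. fscale (cnj (A $ l $ j)) (basis_form {Inr j}))"
  by (simp add: dwb_def dzb_def basis_form_def)

lemma one_form_anticomm:
  fixes f g :: "'m::finite \<Rightarrow> ('n::{finite,linorder}) + 'n"
  shows "wedge (\<Sum>i\<in>UNIV. fscale (a i) (basis_form {f i})) (\<Sum>j\<in>UNIV. fscale (b j) (basis_form {g j}))
     = - wedge (\<Sum>j\<in>UNIV. fscale (b j) (basis_form {g j})) (\<Sum>i\<in>UNIV. fscale (a i) (basis_form {f i}))"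
proof -
  have 1: "wedge (basis_form {i}) (fscale c (basis_form {j})) = - wedge (fscale c (basis_form {j})) (basis_form {i})"
    for c and i j :: "'n + 'n"
    by (subst flin_scale [OF flin_wedge_right], subst flin_scale [OF flin_wedge_left],
        subst wedge_basis_form_singletons_anti) (rule form.scale_minus_right)
  have 2: "wedge (basis_form {i}) (\<Sum>j\<in>UNIV. fscale (b j) (basis_form {g j}))
      = - wedge (\<Sum>j\<in>UNIV. fscale (b j) (basis_form {g j})) (basis_form {i})" for i
    by (simp only: flin_sum [OF flin_wedge_left] flin_sum [OF flin_wedge_right] 1 sum_negf)
  show ?thesis
    by (simp only: flin_sum [OF flin_wedge_left, where g = "\<lambda>i. fscale (a i) (basis_form {f i})"]
        flin_sum [OF flin_wedge_right, where g = "\<lambda>i. fscale (a i) (basis_form {f i})"]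
        flin_scale [OF flin_wedge_left] flin_scale [OF flin_wedge_right] 2 form.scale_minus_right sum_negf)
qed

lemma anticomm_coord: "anticomm (coord A)"
  unfolding anticomm_def coord_def
proof (intro allI)
  fix i j
  show "wedge (case_sum (dw A) (dwb A) i) (case_sum (dw A) (dwb A) j)
      = - wedge (case_sum (dw A) (dwb A) j) (case_sum (dw A) (dwb A) i)"
    by (cases i; cases j; simp only: sum.case dw_basis_form dwb_basis_form; rule one_form_anticomm)
qed

lemma subst_coord_dw: "subst_form (coord A) (dw B l) = dw (B ** A) l"
proof -
  have "subst_form (coord A) (dw B l) = (\<Sum>j\<in>UNIV. \<Sum>k\<in>UNIV. fscale (B $ l $ j * A $ j $ k) (basis_form {Inl k}))"
    by (simp add: dw_basis_form [of B] flin_sum [OF flin_subst_form] flin_scale [OF flin_subst_form]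
        subst_form_basis_form coord_def dw_basis_form [of A] form.scale_sum_right)
  also have "\<dots> = dw (B ** A) l"
    by (subst sum.swap) (simp add: dw_basis_form matrix_matrix_mult_def form.scale_sum_left)
  finally show ?thesis .
qed

lemma subst_coord_dwb: "subst_form (coord A) (dwb B l) = dwb (B ** A) l"
proof -
  have "subst_form (coord A) (dwb B l) = (\<Sum>j\<in>UNIV. \<Sum>k\<in>UNIV. fscale (cnj (B $ l $ j * A $ j $ k)) (basis_form {Inr k}))"
    by (simp add: dwb_basis_form [of B] flin_sum [OF flin_subst_form] flin_scale [OF flin_subst_form]
        subst_form_basis_form coord_def dwb_basis_form [of A] form.scale_sum_right)
  also have "\<dots> = dwb (B ** A) l"
    by (subst sum.swap) (simp add: dwb_basis_form matrix_matrix_mult_def form.scale_sum_left)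
  finally show ?thesis .
qed

lemma dw_mat1: "dw (mat 1) l = basis_form {Inl l}"
proof -
  have "dw (mat 1) l = (\<Sum>j\<in>UNIV. if j = l then basis_form {Inl l} else 0)"
    unfolding dw_basis_form by (intro sum.cong) (auto simp: mat_def)
  then show ?thesis by simp
qed

lemma dwb_mat1: "dwb (mat 1) l = basis_form {Inr l}"
proof -
  have "dwb (mat 1) l = (\<Sum>j\<in>UNIV. if j = l then basis_form {Inr l} else 0)"
    unfolding dwb_basis_form by (intro sum.cong) (auto simp: mat_def)
  then show ?thesis by simp
qed

lemma subst_coord_inverse:
  assumes "B ** A = mat 1"
  shows "subst_form (coord A) (subst_form (coord B) \<alpha>) = \<alpha>"
  by (rule subst_form_inverse [OF anticomm_coord])
     (auto simp: coord_def [of B] subst_coord_dw subst_coord_dwb assms dw_mat1 dwb_mat1 split: sum.split)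

text \<open>Lets computations with forms that are diagonal in the coordinates \<open>A\<close> be
  made in the standard coordinates.\<close>

lemma std11_subst: "std11 A l = subst_form (coord A) (std11 (mat 1) l)"
  by (simp add: std11_def flin_scale [OF flin_subst_form] subst_form_wedge [OF anticomm_coord]
      subst_coord_dw subst_coord_dwb)

section \<open>Bidegrees of wedge products and of substituted forms\<close>

lemma hdeg_Diff: "A \<subseteq> K \<Longrightarrow> hdeg K = hdeg A + hdeg (K - A)"
  for A K :: "('n::finite + 'n) set"
  unfolding hdeg_def by (subst card_Un_disjoint [symmetric]) (auto intro!: arg_cong [of _ _ card])

lemma adeg_Diff: "A \<subseteq> K \<Longrightarrow> adeg K = adeg A + adeg (K - A)"
  for A K :: "('n::finite + 'n) set"
  unfolding adeg_def by (subst card_Un_disjoint [symmetric]) (auto intro!: arg_cong [of _ _ card])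

lemma Vpq_wedge:
  assumes "\<alpha> \<in> Vpq p q" "\<beta> \<in> Vpq r s"
  shows "wedge \<alpha> \<beta> \<in> Vpq (p + r) (q + s)"
  unfolding Vpq_def
proof (intro CollectI allI impI)
  fix K
  assume "wedge \<alpha> \<beta> K \<noteq> 0"
  then obtain A where "A \<subseteq> K" "\<alpha> A \<noteq> 0" "\<beta> (K - A) \<noteq> 0"
    unfolding wedge_def by (metis (mono_tags, lifting) mem_Collect_eq mult_eq_0_iff sum.neutral)
  then show "hdeg K = p + r \<and> adeg K = q + s"
    using assms hdeg_Diff [of A K] adeg_Diff [of A K] by (auto simp: Vpq_def)
qed

lemma Vpq_0: "0 \<in> Vpq p q"
  by (simp add: Vpq_def)

lemma Vpq_add: "\<alpha> \<in> Vpq p q \<Longrightarrow> \<beta> \<in> Vpq p q \<Longrightarrow> \<alpha> + \<beta> \<in> Vpq p q"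
  unfolding Vpq_def by (simp add: plus_fun_def) (metis add_0)

lemma Vpq_diff: "\<alpha> \<in> Vpq p q \<Longrightarrow> \<beta> \<in> Vpq p q \<Longrightarrow> \<alpha> - \<beta> \<in> Vpq p q"
  unfolding Vpq_def by (simp add: fun_diff_def) (metis diff_self)

lemma Vpq_fscale: "\<alpha> \<in> Vpq p q \<Longrightarrow> fscale c \<alpha> \<in> Vpq p q"
  by (auto simp: Vpq_def fscale_def)

lemma Vpq_sum: "(\<And>i. i \<in> S \<Longrightarrow> f i \<in> Vpq p q) \<Longrightarrow> (\<Sum>i\<in>S. f i) \<in> Vpq p q"
  by (induction S rule: infinite_finite_induct) (simp_all add: Vpq_0 Vpq_add)

lemma Vpq_basis_form: "basis_form K \<in> Vpq (hdeg K) (adeg K)"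
  by (auto simp: Vpq_def basis_form_def split: if_splits)

lemma coord_Vpq: "coord A j \<in> Vpq (hdeg {j}) (adeg {j})"
proof (cases j)
  case (Inl l)
  have "basis_form {Inl i} \<in> Vpq (hdeg {j}) (adeg {j})" for i
    using Vpq_basis_form [of "{Inl i}"] by (simp add: hdeg_def adeg_def Inl vimage_def)
  then show ?thesis using Inl by (auto simp: coord_def dw_basis_form intro!: Vpq_sum Vpq_fscale)
next
  case (Inr l)
  have "basis_form {Inr i} \<in> Vpq (hdeg {j}) (adeg {j})" for i
    using Vpq_basis_form [of "{Inr i}"] by (simp add: hdeg_def adeg_def Inr vimage_def)
  then show ?thesis using Inr by (auto simp: coord_def dwb_basis_form intro!: Vpq_sum Vpq_fscale)
qed

lemma ordprod_coord_Vpq: "ordprod (coord A) K \<in> Vpq (hdeg K) (adeg K)"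
proof (induction K rule: olt_induct)
  case empty
  then show ?case by (simp add: Vpq_basis_form)
next
  case (insert m K)
  then have "insert m K - {m} = K" by auto
  then show ?case
    using Vpq_wedge [OF coord_Vpq insert.IH, of A m] insert.hyps
      hdeg_Diff [of "{m}" "insert m K"] adeg_Diff [of "{m}" "insert m K"]
    by (simp add: ordprod_insert)
qed

lemma subst_coord_Vpq: "\<alpha> \<in> Vpq p q \<Longrightarrow> subst_form (coord A) \<alpha> \<in> Vpq p q"
  unfolding subst_form_def
proof (intro Vpq_sum)
  fix K assume "\<alpha> \<in> Vpq p q"
  then show "fscale (\<alpha> K) (ordprod (coord A) K) \<in> Vpq p q"
    using ordprod_coord_Vpq [of A K]
    by (cases "\<alpha> K = 0") (auto simp: Vpq_def fscale_def)
qed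

section \<open>Injectivity suffices, and the diagonal case\<close>

text \<open>Source and target have equally many monomials, so a trivial kernel already makes the map
  bijective.\<close>

lemma lefschetzI:
  fixes \<Omega> :: "('n::{finite,linorder}) form"
  assumes \<Omega>: "\<Omega> \<in> Vpq 2 2" and pq: "p + q = CARD('n) - 2" "CARD('n) \<ge> 2"
    and inj: "\<And>\<alpha>. \<alpha> \<in> Vpq p q \<Longrightarrow> wedge \<alpha> \<Omega> = 0 \<Longrightarrow> \<alpha> = 0"
  shows "lefschetz \<Omega> p q"
proof -
  \<comment> \<open>\<open>\<phi>\<close> exchanges each dz_j with its conjugate and takes
    complements, so it carries bidegree (p, q) to (n - q, n - p).\<close>
  define \<phi> :: "('n + 'n) set \<Rightarrow> ('n + 'n) set" where "\<phi> K = {x. case_sum Inr Inl x \<notin> K}" for K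
  have \<phi>\<phi>: "\<phi> (\<phi> K) = K" for K
  proof -
    have "case_sum Inr Inl (case_sum Inr Inl x) = x" for x :: "'n + 'n" by (cases x) auto
    then show ?thesis by (simp add: \<phi>_def)
  qed
  have "Inl -` \<phi> K = - (Inr -` K)" "Inr -` \<phi> K = - (Inl -` K)" for K
    by (auto simp: \<phi>_def)
  then have deg: "hdeg (\<phi> K) = CARD('n) - adeg K" "adeg (\<phi> K) = CARD('n) - hdeg K" for K
    by (simp_all add: hdeg_def adeg_def Compl_eq_Diff_UNIV card_Diff_subset)
  have le: "hdeg K \<le> CARD('n)" "adeg K \<le> CARD('n)" for K :: "('n + 'n) set"
    by (simp_all add: hdeg_def adeg_def card_mono)
  \<comment> \<open>The involution \<phi> matches the basis of the target with that of the source, so that wedging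
    with \<Omega>, extended by the identity, becomes an endomorphism G of the space of all forms.\<close>
  define D where "D K \<longleftrightarrow> hdeg K = p \<and> adeg K = q" for K :: "('n + 'n) set"
  have np: "CARD('n) - q = p + 2" "CARD('n) - p = q + 2"
    using pq by auto
  have D\<phi>: "D (\<phi> K) \<longleftrightarrow> hdeg K = p + 2 \<and> adeg K = q + 2" for K
    using pq le [of K] by (auto simp: D_def deg)
  have Vpq_iff: "\<alpha> \<in> Vpq p q \<longleftrightarrow> (\<forall>K. \<not> D K \<longrightarrow> \<alpha> K = 0)" for \<alpha>
    by (auto simp: Vpq_def D_def)
  define pr :: "'n form \<Rightarrow> 'n form" where "pr \<alpha> = (\<lambda>K. if D K then \<alpha> K else 0)" for \<alpha>
  have pr_V: "pr \<alpha> \<in> Vpq p q" for \<alpha> by (simp add: pr_def Vpq_iff)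
  have wV: "wedge \<alpha> \<Omega> \<in> Vpq (p + 2) (q + 2)" if "\<alpha> \<in> Vpq p q" for \<alpha>
    using that \<Omega> by (rule Vpq_wedge)
  define G :: "'n form \<Rightarrow> 'n form" where
    "G \<alpha> = (\<lambda>K. if D K then wedge (pr \<alpha>) \<Omega> (\<phi> K) else \<alpha> K)" for \<alpha>
  have "flin pr"
    by (rule flinI) (auto simp: pr_def fscale_def fun_eq_iff)
  then have L: "flin (\<lambda>\<alpha>. wedge (pr \<alpha>) \<Omega>)"
    by (rule flin_comp [OF flin_wedge_left])
  have G: "flin G"
  proof (rule flinI)
    show "G (\<alpha> + \<beta>) = G \<alpha> + G \<beta>" for \<alpha> \<beta>
      using form2.linear_add [OF L, of \<alpha> \<beta>] by (auto simp: G_def fun_eq_iff)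
    show "G (fscale c \<alpha>) = fscale c (G \<alpha>)" for c \<alpha>
      using form2.linear_scale [OF L, of c \<alpha>] by (auto simp: G_def fun_eq_iff fscale_apply)
  qed
  have eq: "wedge \<alpha> \<Omega> = \<beta>" if "\<alpha> \<in> Vpq p q" "\<beta> \<in> Vpq (p + 2) (q + 2)"
    "\<And>K. D K \<Longrightarrow> wedge \<alpha> \<Omega> (\<phi> K) = \<beta> (\<phi> K)" for \<alpha> \<beta>
  proof
    fix K
    show "wedge \<alpha> \<Omega> K = \<beta> K"
    proof (cases "D (\<phi> K)")
      case True
      then show ?thesis using that(3) [of "\<phi> K"] by (simp add: \<phi>\<phi>)
    next
      case False
      then have "wedge \<alpha> \<Omega> K = 0" "\<beta> K = 0"
        using wV [OF that(1)] that(2) unfolding D\<phi> Vpq_def by blast+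
      then show ?thesis by simp
    qed
  qed
  have "inj G"
    unfolding form2.linear_inj_iff_eq_0 [OF G]
  proof (intro allI impI)
    fix \<alpha> assume 0: "G \<alpha> = 0"
    have "\<alpha> K = 0" if "\<not> D K" for K
      using fun_cong [OF 0, of K] that by (simp add: G_def)
    then have \<alpha>: "\<alpha> \<in> Vpq p q" by (simp add: Vpq_iff)
    then have "pr \<alpha> = \<alpha>" by (auto simp: pr_def fun_eq_iff Vpq_iff)
    then have "wedge \<alpha> \<Omega> (\<phi> K) = 0" if "D K" for K
      using fun_cong [OF 0, of K] that by (simp add: G_def)
    then have "wedge \<alpha> \<Omega> = 0"
      by (intro eq [OF \<alpha> Vpq_0]) simp
    with \<alpha> show "\<alpha> = 0" by (rule inj)
  qed
  then have "surj G"
    by (rule form.linear_inj_imp_surj [OF G])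
  have "inj_on (\<lambda>\<alpha>. wedge \<alpha> \<Omega>) (Vpq p q)"
  proof (rule inj_onI)
    fix \<alpha> \<beta> :: "'n form"
    assume "\<alpha> \<in> Vpq p q" "\<beta> \<in> Vpq p q" "wedge \<alpha> \<Omega> = wedge \<beta> \<Omega>"
    then show "\<alpha> = \<beta>"
      using inj [of "\<alpha> - \<beta>"] by (simp add: Vpq_diff form2.linear_diff [OF flin_wedge_left])
  qed
  moreover have "(\<lambda>\<alpha>. wedge \<alpha> \<Omega>) ` Vpq p q = Vpq (p + 2) (q + 2)"
  proof (intro equalityI subsetI)
    fix \<beta> :: "'n form"
    assume \<beta>: "\<beta> \<in> Vpq (p + 2) (q + 2)"
    \<comment> \<open>The target form is transported back along \<open>\<phi>\<close>; projecting a
      preimage under \<open>G\<close> to bidegree (p, q) then gives a preimage under the wedge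
      map.\<close>
    obtain \<alpha> where \<alpha>: "G \<alpha> = (\<lambda>K. if D K then \<beta> (\<phi> K) else 0)"
      using \<open>surj G\<close> by (metis surjD)
    have "wedge (pr \<alpha>) \<Omega> (\<phi> K) = \<beta> (\<phi> K)" if "D K" for K
    proof -
      have "G \<alpha> K = \<beta> (\<phi> K)" using that by (simp add: \<alpha>)
      then show ?thesis using that by (simp add: G_def)
    qed
    then have "wedge (pr \<alpha>) \<Omega> = \<beta>"
      by (intro eq pr_V \<beta>)
    then show "\<beta> \<in> (\<lambda>\<alpha>. wedge \<alpha> \<Omega>) ` Vpq p q"
      using pr_V by blast
  qed (use wV in blast)
  ultimately show ?thesis
    using \<Omega> pq unfolding lefschetz_def np by (simp add: bij_betw_def)
qed

section \<open>Products with diagonal (2,2)-forms in standard coordinates\<close>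

definition pair_set :: "'n set \<Rightarrow> ('n + 'n) set" where
  "pair_set T = Inl ` T \<union> Inr ` T"

lemma pair_set_insert: "pair_set (insert t T) = pair_set {t} \<union> pair_set T"
  by (auto simp: pair_set_def)

text \<open>The inversions inside the \<open>Inl\<close> block and inside the \<open>Inr\<close>
  block occur together and cancel; what remains is the one inversion between \<open>Inr l\<close>
  and \<open>Inl m\<close>.\<close>

lemma wsign_pair_set_singletons:
  fixes l m :: "'n::{finite,linorder}"
  assumes "l \<noteq> m"
  shows "wsign (pair_set {l}) (pair_set {m}) = -1"
proof -
  have Q: "pair_set {t} = {Inl t} \<union> {Inr t}" for t :: 'n by (auto simp: pair_set_def)
  have "wsign (pair_set {l}) (pair_set {m}) =
      (wsign {Inl l} {Inl m} * wsign {Inl l} {Inr m}) * (wsign {Inr l} {Inl m} * wsign {Inr l} {Inr m})"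
    unfolding Q by (subst wsign_Un_left, simp, subst wsign_Un_right, simp, subst wsign_Un_right, simp, rule refl)
  then show ?thesis by (simp add: wsign_singletons)
qed

lemma wsign_sq: "wsign A B * wsign A B = 1"
  by (simp add: wsign_def flip: power_add mult_2)

lemma std11_mat1: "std11 (mat 1) l = fscale (\<i> / 2) (basis_form (pair_set {l}))"
proof -
  have "pair_set {l} = {Inl l, Inr l}" by (auto simp: pair_set_def)
  then show ?thesis
    by (simp add: std11_def dw_mat1 dwb_mat1 wedge_basis_form wsign_singletons insert_commute)
qed

text \<open>The factor 1/4 is the square of \<i>/2 times the sign -1 from reordering the two
  pairs.\<close>

lemma std11_mat1_wedge:
  "wedge (std11 (mat 1) l) (std11 (mat 1) m) = (if l = m then 0 else fscale (1/4) (basis_form (pair_set {l, m})))"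
proof -
  have "pair_set {l} \<inter> pair_set {m} = (if l = m then pair_set {l} else {})" "pair_set {l} \<noteq> {}" "pair_set {m} \<noteq> {}"
    by (auto simp: pair_set_def)
  moreover have "pair_set {l} \<union> pair_set {m} = pair_set {l, m}"
    by (auto simp: pair_set_def)
  ultimately show ?thesis
    by (simp add: std11_mat1 flin_scale [OF flin_wedge_left] flin_scale [OF flin_wedge_right]
        wedge_basis_form wsign_pair_set_singletons)
qed

text \<open>The sum runs over ordered pairs, while the factors commute and have square 0; so the
  form depends only on \<open>g l m + g m l\<close> for \<open>l \<noteq> m\<close>.\<close>

definition diag22 :: "('n \<Rightarrow> 'n \<Rightarrow> complex) \<Rightarrow> ('n::{finite,linorder}) form" where
  "diag22 g = (\<Sum>l\<in>UNIV. \<Sum>m\<in>UNIV. fscale (g l m) (wedge (std11 (mat 1) l) (std11 (mat 1) m)))"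

text \<open>A term contributes at \<open>K\<close> only if \<open>K\<close> contains both complete
  pairs, and it then reads off the coefficient of \<open>\<alpha>\<close> at \<open>K\<close>
  without them.\<close>

lemma wedge_diag22:
  fixes \<alpha> :: "('n::{finite,linorder}) form"
  assumes D: "D = {t. Inl t \<in> K \<and> Inr t \<in> K}"
  shows "wedge \<alpha> (diag22 g) K = (\<Sum>l\<in>D. \<Sum>m\<in>D. if l = m then 0 else
    g l m / 4 * wsign (K - pair_set {l, m}) (pair_set {l, m}) * \<alpha> (K - pair_set {l, m}))"
proof -
  define h where "h l m = (if l = m then 0 else
    g l m / 4 * wsign (K - pair_set {l, m}) (pair_set {l, m}) * \<alpha> (K - pair_set {l, m}))" for l m
  have "wedge \<alpha> (diag22 g) K
      = (\<Sum>l\<in>UNIV. \<Sum>m\<in>UNIV. g l m * wedge \<alpha> (wedge (std11 (mat 1) l) (std11 (mat 1) m)) K)"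
    unfolding diag22_def
    by (simp only: flin_sum [OF flin_wedge_right] flin_scale [OF flin_wedge_right] sum_form_apply fscale_apply)
  also have "\<dots> = (\<Sum>l\<in>UNIV. \<Sum>m\<in>UNIV. if l \<in> D \<and> m \<in> D then h l m else 0)"
  proof (intro sum.cong refl)
    fix l m
    have "pair_set {l, m} \<subseteq> K \<longleftrightarrow> l \<in> D \<and> m \<in> D" by (auto simp: pair_set_def D)
    then show "g l m * wedge \<alpha> (wedge (std11 (mat 1) l) (std11 (mat 1) m)) K
        = (if l \<in> D \<and> m \<in> D then h l m else 0)"
      by (simp add: std11_mat1_wedge flin_scale [OF flin_wedge_right] fscale_apply wedge_basis_form_right h_def
          form2.linear_0 [OF flin_wedge_right])
  qed
  also have "\<dots> = (\<Sum>l\<in>UNIV. if l \<in> D then \<Sum>m\<in>D. h l m else 0)"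
    by (intro sum.cong) (simp_all add: sum.If_cases)
  also have "\<dots> = (\<Sum>l\<in>D. \<Sum>m\<in>D. h l m)"
    by (simp add: sum.If_cases)
  finally show ?thesis by (simp add: h_def)
qed

text \<open>Since \<open>p \<le> 1\<close> or \<open>q \<le> 1\<close>, an index set
  \<open>B\<close> in the support of \<open>\<alpha>\<close> contains at most one complete pair.
  Without a pair, one coefficient of the product is a nonzero multiple of \<open>\<alpha> B\<close>.
  With one pair, \<open>\<alpha> B\<close> is an unknown in a 4x4 system with nonzero
  determinant.\<close>

lemma diag22_injective:
  fixes \<alpha> :: "('n::{finite,linorder}) form" and g :: "'n \<Rightarrow> 'n \<Rightarrow> complex"
  defines "c \<equiv> \<lambda>l m. g l m + g m l"
  assumes \<alpha>: "\<alpha> \<in> Vpq p q" and pq: "p + q = CARD('n) - 2" "CARD('n) \<ge> 2" "p \<le> 1 \<or> q \<le> 1"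
    and nz: "\<And>l m. l \<noteq> m \<Longrightarrow> c l m \<noteq> 0"
    and det: "\<And>i j k l. distinct [i, j, k, l] \<Longrightarrow>
      (c i j * c k l)\<^sup>2 + (c i k * c j l)\<^sup>2 + (c i l * c j k)\<^sup>2 - 2 * (c i j * c k l) * (c i k * c j l)
      - 2 * (c i k * c j l) * (c i l * c j k) - 2 * (c i j * c k l) * (c i l * c j k) \<noteq> 0"
    and 0: "wedge \<alpha> (diag22 g) = 0"
  shows "\<alpha> = 0"
proof (rule ext, rule ccontr)
  fix B
  assume "\<alpha> B \<noteq> 0 B"
  then have B: "\<alpha> B \<noteq> 0" by simp
  define I J where "I = Inl -` B" and "J = Inr -` B"
  have card: "card I = p" "card J = q"
    using \<alpha> B by (auto simp: Vpq_def hdeg_def adeg_def I_def J_def)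
  \<comment> \<open>Y and Z are the sets of t for which both, respectively neither, of dz_t and its conjugate
    occur in B.\<close>
  define Y Z where "Y = I \<inter> J" and "Z = - (I \<union> J)"
  have "card (I \<union> J) + card Y = p + q"
    using card_Un_Int [of I J] card by (simp add: Y_def)
  moreover have "card Z = CARD('n) - card (I \<union> J)"
    by (simp add: Z_def Compl_eq_Diff_UNIV card_Diff_subset)
  moreover have "card (I \<union> J) \<le> CARD('n)" by (simp add: card_mono)
  ultimately have Z: "card Z = card Y + 2" using pq by linarith
  have "card Y \<le> p" "card Y \<le> q"
    using card by (auto simp: Y_def intro: card_mono)
  with pq(3) have "card Y = 0 \<or> card Y = 1" by linarith
  then show False
  proof
    assume Y: "card Y = 0"
    then have "card Z = 2" using Z by simp
    then obtain l m where lm: "Z = {l, m}" "l \<noteq> m" by (auto simp: card_2_iff)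
    have disj: "B \<inter> pair_set Z = {}" by (auto simp: pair_set_def Z_def I_def J_def)
    have "Y = {}" using Y by simp
    \<comment> \<open>The complete pairs in \<open>B \<union> pair_set Z\<close> are those at
      \<open>l\<close> and \<open>m\<close> only, so this coefficient of the product involves
      \<open>\<alpha>\<close> at \<open>B\<close> alone.\<close>
    then have "{l, m} = {t. Inl t \<in> B \<union> pair_set Z \<and> Inr t \<in> B \<union> pair_set Z}"
      by (auto simp: pair_set_def Y_def I_def J_def lm)
    from wedge_diag22 [OF this, of \<alpha> g]
    have "c l m * (wsign B (pair_set Z) * \<alpha> B) / 4 = 0"
      using disj lm 0 by (simp add: Un_Diff Diff_triv insert_commute [of m l] c_def algebra_simps add_divide_distrib)
    with B nz [OF lm(2)] wsign_sq [of B "pair_set Z"] show False by auto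
  next
    assume Y: "card Y = 1"
    then obtain j where j: "Y = {j}" by (auto simp: card_1_singleton_iff)
    have "card Z = 3" using Y Z by simp
    then obtain x y z where xyz: "Z = {x, y, z}" "distinct [x, y, z]" 
      by (auto simp: card_3_iff)
    have jZ: "j \<notin> Z" using j by (auto simp: Y_def Z_def)
    then have dist: "distinct [j, x, y, z]" using xyz by auto
    \<comment> \<open>\<open>B0\<close> keeps the unpaired factors. The monomials of
      \<open>B0 \<union> pair_set {t}\<close> for \<open>t\<close> in \<open>{j, x, y, z}\<close>
      span the weight space of \<open>B\<close>, and \<open>F t\<close> are the coefficients of
      \<open>\<alpha>\<close> there.\<close>
    define B0 where "B0 = B - pair_set {j}"
    have B0: "B0 \<union> pair_set {j} = B"
      using j by (auto simp: B0_def pair_set_def Y_def I_def J_def)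
    define F where "F t = \<alpha> (B0 \<union> pair_set {t})" for t
    define \<sigma> where "\<sigma> t = wsign B0 (pair_set {t})" for t
    \<comment> \<open>The signs of the wedge products turn c into a symmetric rescaling C of c, which changes
      the determinant only by the square of a sign.\<close>
    define C where "C s t = c s t * \<sigma> s * \<sigma> t" for s t
    have B0_notin: "Inl t \<notin> B0 \<and> Inr t \<notin> B0" if "t \<in> {j, x, y, z}" for t
      using that xyz by (auto simp: B0_def pair_set_def Z_def I_def J_def)
    have B0_both: "\<not> (Inl t \<in> B0 \<and> Inr t \<in> B0)" for t
      using j by (auto simp: B0_def pair_set_def Y_def I_def J_def)
    \<comment> \<open>Moving the pair of \<open>t\<close> past those of \<open>r\<close> and
      \<open>s\<close> produces two signs -1, which cancel.\<close>
    have sgn: "wsign (B0 \<union> pair_set {t}) (pair_set {r, s}) = \<sigma> r * \<sigma> s"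
      if "distinct [r, s, t]" "r \<in> {j, x, y, z}" "s \<in> {j, x, y, z}" "t \<in> {j, x, y, z}" for r s t
    proof -
      have "B0 \<inter> pair_set {t} = {}" "pair_set {r} \<inter> pair_set {s} = {}"
        using that B0_notin by (auto simp: pair_set_def)
      moreover have "t \<noteq> r" "t \<noteq> s" using that by auto
      ultimately show ?thesis
        by (simp add: pair_set_insert [of r "{s}"] wsign_Un_left wsign_Un_right
            wsign_pair_set_singletons \<sigma>_def)
    qed
    \<comment> \<open>The coefficient of the product at \<open>B0\<close> with three pairs added:
      removing two of them leaves the third, which gives three terms.\<close>
    have eq: "C r s * F t + C r t * F s + C s t * F r = 0"
      if d: "distinct [r, s, t]" and S: "r \<in> {j, x, y, z}" "s \<in> {j, x, y, z}" "t \<in> {j, x, y, z}" for r s t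
    proof -
      define K where "K = B0 \<union> pair_set {r, s, t}"
      have D: "{r, s, t} = {t. Inl t \<in> K \<and> Inr t \<in> K}"
        using B0_both by (auto simp: K_def pair_set_def)
      have KQ: "K - pair_set {r, s} = B0 \<union> pair_set {t}" "K - pair_set {r, t} = B0 \<union> pair_set {s}" "K - pair_set {s, t} = B0 \<union> pair_set {r}"
        using d B0_notin [OF S(1)] B0_notin [OF S(2)] B0_notin [OF S(3)] by (auto simp: K_def pair_set_def)
      have "s \<noteq> r" "t \<noteq> r" "t \<noteq> s" using d by auto
      then have "wedge \<alpha> (diag22 g) K = (C r s * F t + C r t * F s + C s t * F r) / 4"
        using sgn [of r s t] sgn [of r t s] sgn [of s t r] S wedge_diag22 [OF D, of \<alpha> g]
        by (simp add: insert_commute [of s r] insert_commute [of t r] insert_commute [of t s] KQ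
            C_def c_def F_def [symmetric] algebra_simps add_divide_distrib)
      then show ?thesis using 0 by simp
    qed
    define e where "e = \<sigma> j * \<sigma> x * \<sigma> y * \<sigma> z"
    have e: "e * e = 1"
    proof -
      have "\<sigma> t * \<sigma> t = 1" for t by (simp add: \<sigma>_def wsign_sq)
      then show ?thesis by (simp add: e_def mult_ac)
    qed
    have C: "C j x * C y z = e * (c j x * c y z)" "C j y * C x z = e * (c j y * c x z)"
       "C j z * C x y = e * (c j z * c x y)"
      by (simp_all add: C_def e_def mult_ac)
    have "(C j x * C y z)\<^sup>2 + (C j y * C x z)\<^sup>2 + (C j z * C x y)\<^sup>2 - 2 * (C j x * C y z) * (C j y * C x z)
      - 2 * (C j y * C x z) * (C j z * C x y) - 2 * (C j x * C y z) * (C j z * C x y)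
      = e * e * ((c j x * c y z)\<^sup>2 + (c j y * c x z)\<^sup>2 + (c j z * c x y)\<^sup>2 - 2 * (c j x * c y z) * (c j y * c x z)
      - 2 * (c j y * c x z) * (c j z * c x y) - 2 * (c j x * c y z) * (c j z * c x y))"
      unfolding C by (simp only: power2_eq_square) algebra
    then have "(C j x * C y z)\<^sup>2 + (C j y * C x z)\<^sup>2 + (C j z * C x y)\<^sup>2 - 2 * (C j x * C y z) * (C j y * C x z)
      - 2 * (C j y * C x z) * (C j z * C x y) - 2 * (C j x * C y z) * (C j z * C x y) \<noteq> 0"
      using det [OF dist] unfolding e by simp
    then have "F j = 0"
    proof (rule zero_diagonal_kernel4)
      show "F x * C y z + F y * C x z + F z * C x y = 0"
        using eq [of x y z] dist by (simp add: algebra_simps)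
      show "F j * C y z + F y * C j z + F z * C j y = 0"
        using eq [of j y z] dist by (simp add: algebra_simps)
      show "F j * C x z + F x * C j z + F z * C j x = 0"
        using eq [of j x z] dist by (simp add: algebra_simps)
      show "F j * C x y + F x * C j y + F y * C j x = 0"
        using eq [of j x y] dist by (simp add: algebra_simps)
    qed
    with B show False by (simp add: F_def B0)
  qed
qed

section \<open>Positivity of the coefficient matrices\<close>

lemma std11_apply:
  "std11 A l {Inl j, Inr k} = \<i> / 2 * (A $ l $ j * cnj (A $ l $ k))"
proof -
  have "wedge (dw A l) (dwb A l) =
      (\<Sum>a\<in>UNIV. \<Sum>b\<in>UNIV. fscale (A $ l $ a * cnj (A $ l $ b)) (basis_form {Inl a, Inr b}))"
    by (simp only: dw_basis_form flin_sum [OF flin_wedge_left] flin_scale [OF flin_wedge_left])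
       (simp add: dwb_basis_form flin_sum [OF flin_wedge_right] flin_scale [OF flin_wedge_right] form.scale_sum_right
        wedge_basis_form wsign_singletons insert_commute)
  then have "wedge (dw A l) (dwb A l) {Inl j, Inr k} =
      (\<Sum>a\<in>UNIV. \<Sum>b\<in>UNIV. A $ l $ a * cnj (A $ l $ b) * basis_form {Inl a, Inr b} {Inl j, Inr k})"
    by (simp add: sum_form_apply fscale_apply)
  also have "\<dots> = (\<Sum>a\<in>UNIV. \<Sum>b\<in>UNIV. if b = k then if a = j then A $ l $ j * cnj (A $ l $ k) else 0 else 0)"
  proof (intro sum.cong refl)
    fix a b
    have "{Inl j, Inr k} = {Inl a, Inr b} \<longleftrightarrow> a = j \<and> b = k" by auto
    then show "A $ l $ a * cnj (A $ l $ b) * basis_form {Inl a, Inr b} {Inl j, Inr k}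
        = (if b = k then if a = j then A $ l $ j * cnj (A $ l $ k) else 0 else 0)"
      by (simp add: basis_form_def)
  qed
  also have "\<dots> = A $ l $ j * cnj (A $ l $ k)" by simp
  finally show ?thesis by (simp add: std11_def fscale_apply)
qed

text \<open>Comparing coefficients in the coordinates that diagonalize the left side expresses
  \<open>f t\<close> as the squared norm of column \<open>t\<close> of \<open>A' ** Ai\<close>. This
  column is nonzero because the matrix is invertible.\<close>

lemma diagonal_kahler_pos:
  fixes A :: "complex^('n::{finite,linorder})^('n::{finite,linorder})"
  assumes "is_kahler (\<Sum>l\<in>UNIV. fscale (f l) (std11 A l))" "invertible A"
  shows "\<exists>r>0. f t = complex_of_real r"
proof -
  obtain A' :: "complex^('n::{finite,linorder})^('n::{finite,linorder})" where A': "invertible A'"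
    and eq: "(\<Sum>l\<in>UNIV. fscale (f l) (std11 A l)) = (\<Sum>l\<in>UNIV. std11 A' l)"
    using assms(1) by (auto simp: is_kahler_def)
  obtain Ai where Ai: "A ** Ai = mat 1"
    using assms(2) by (auto simp: invertible_def)
  obtain Ai' where Ai': "Ai' ** A' = mat 1"
    using A' by (auto simp: invertible_def)
  have coeff: "(\<Sum>l\<in>UNIV. f l * (A $ l $ j * cnj (A $ l $ k))) = (\<Sum>l\<in>UNIV. A' $ l $ j * cnj (A' $ l $ k))" for j k
  proof -
    have "\<i> / 2 * (\<Sum>l\<in>UNIV. f l * (A $ l $ j * cnj (A $ l $ k))) = (\<Sum>l\<in>UNIV. fscale (f l) (std11 A l)) {Inl j, Inr k}"
      by (simp only: sum_form_apply fscale_apply std11_apply sum_distrib_left mult.left_commute)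
    also have "\<dots> = \<i> / 2 * (\<Sum>l\<in>UNIV. A' $ l $ j * cnj (A' $ l $ k))"
      by (simp only: eq sum_form_apply std11_apply sum_distrib_left)
    finally show ?thesis by simp
  qed
  \<comment> \<open>Evaluates the Hermitian form with weights \<open>h\<close> in the coordinates
    \<open>B\<close> at column \<open>t\<close> of \<open>Ai\<close>; for \<open>B = A\<close> this
    isolates the weight of index \<open>t\<close>.\<close>
  have quad: "(\<Sum>j\<in>UNIV. \<Sum>k\<in>UNIV. Ai $ j $ t * cnj (Ai $ k $ t) * (\<Sum>l\<in>UNIV. h l * (B $ l $ j * cnj (B $ l $ k))))
     = (\<Sum>l\<in>UNIV. h l * ((B ** Ai) $ l $ t * cnj ((B ** Ai) $ l $ t)))" for h and B :: "complex^('n::{finite,linorder})^('n::{finite,linorder})"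
  proof -
    have "(\<Sum>l\<in>UNIV. h l * ((B ** Ai) $ l $ t * cnj ((B ** Ai) $ l $ t)))
      = (\<Sum>l\<in>UNIV. \<Sum>j\<in>UNIV. \<Sum>k\<in>UNIV. Ai $ j $ t * cnj (Ai $ k $ t) * (h l * (B $ l $ j * cnj (B $ l $ k))))"
      by (simp only: matrix_matrix_mult_def vec_lambda_beta cnj_sum sum_product complex_cnj_mult)
         (simp only: sum_distrib_left mult_ac)
    also have "\<dots> = (\<Sum>j\<in>UNIV. \<Sum>l\<in>UNIV. \<Sum>k\<in>UNIV. Ai $ j $ t * cnj (Ai $ k $ t) * (h l * (B $ l $ j * cnj (B $ l $ k))))"
      by (rule sum.swap)
    also have "\<dots> = (\<Sum>j\<in>UNIV. \<Sum>k\<in>UNIV. \<Sum>l\<in>UNIV. Ai $ j $ t * cnj (Ai $ k $ t) * (h l * (B $ l $ j * cnj (B $ l $ k))))"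
      by (intro sum.cong refl sum.swap)
    finally show ?thesis by (simp only: sum_distrib_left)
  qed
  define v where "v l = (A' ** Ai) $ l $ t" for l
  have "f t = (\<Sum>l\<in>UNIV. f l * ((A ** Ai) $ l $ t * cnj ((A ** Ai) $ l $ t)))"
  proof -
    have "(\<Sum>l\<in>UNIV. f l * ((A ** Ai) $ l $ t * cnj ((A ** Ai) $ l $ t))) = (\<Sum>l\<in>UNIV. if l = t then f t else 0)"
      unfolding Ai by (intro sum.cong) (auto simp: mat_def)
    then show ?thesis by simp
  qed
  also have "\<dots> = (\<Sum>l\<in>UNIV. 1 * (v l * cnj (v l)))"
    unfolding quad [symmetric] v_def coeff by simp
  also have "\<dots> = complex_of_real (\<Sum>l\<in>UNIV. (cmod (v l))\<^sup>2)"
    by (simp only: of_real_sum complex_norm_square mult_1)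
  finally have ft: "f t = complex_of_real (\<Sum>l\<in>UNIV. (cmod (v l))\<^sup>2)" .
  have "\<exists>l. v l \<noteq> 0"
  proof (rule ccontr)
    assume "\<not> (\<exists>l. v l \<noteq> 0)"
    then have "((A ** Ai') ** (A' ** Ai)) $ t $ t = 0"
      by (simp add: matrix_matrix_mult_def [of "A ** Ai'"] v_def)
    moreover have "(A ** Ai') ** (A' ** Ai) = mat 1"
      by (metis Ai Ai' matrix_mul_assoc matrix_mul_lid)
    ultimately show False by (simp add: mat_def)
  qed
  then obtain l where "v l \<noteq> 0" ..
  then have "(\<Sum>l\<in>UNIV. (cmod (v l))\<^sup>2) > 0"
    by (intro sum_pos2 [of UNIV l]) auto
  with ft show ?thesis by blast
qed

text \<open>Real values at (1,0), (0,1), (1,1) and (1,\<i>) force the matrix to be Hermitian, and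
  positivity at one further vector gives the determinant condition.\<close>

lemma hermitian_pos_def2:
  fixes b11 b12 b21 b22 :: complex
  assumes pos: "\<And>x y. x \<noteq> 0 \<or> y \<noteq> 0 \<Longrightarrow>
    \<exists>r>0. x * cnj x * b11 + x * cnj y * b12 + y * cnj x * b21 + y * cnj y * b22 = complex_of_real r"
  shows "\<exists>p r s t. b11 = of_real p \<and> b22 = of_real r \<and> b12 = Complex s t \<and> b21 = Complex s (- t)
    \<and> p > 0 \<and> p * r > s\<^sup>2 + t\<^sup>2"
proof -
  obtain p where p: "p > 0" "b11 = of_real p" using pos [of 1 0] by auto
  obtain r where r: "r > 0" "b22 = of_real r" using pos [of 0 1] by auto
  obtain s t where b12: "b12 = Complex s t" by (cases b12)
  obtain s' t' where b21: "b21 = Complex s' t'" by (cases b21)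
  have t': "t' = - t" using pos [of 1 1] by (auto simp: p r b12 b21 complex_eq_iff)
  have s': "s' = s" using pos [of 1 \<i>] by (auto simp: p r b12 b21 complex_eq_iff)
  \<comment> \<open>At this vector the form takes the value \<open>p\<close> times the
    determinant.\<close>
  obtain w where w: "w > 0" "b12 * cnj b12 * of_real p - b12 * of_real p * cnj b12 * 1
      + (- of_real p * b12 * b21 + of_real p * of_real p * of_real r) = complex_of_real w"
    using pos [of "- cnj b12" "of_real p"] p by (auto simp: r algebra_simps)
  have "w = p * (p * r - (s\<^sup>2 + t\<^sup>2))"
    using w(2) by (simp add: b12 b21 t' s' complex_eq_iff power2_eq_square algebra_simps)
  with w(1) p(1) have "p * r > s\<^sup>2 + t\<^sup>2"
    by (simp add: zero_less_mult_iff)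
  then show ?thesis using p r b12 b21 s' t' by blast
qed

section \<open>Reduction to the diagonal form in standard coordinates\<close>

theorem mainTheorem13:
  fixes M :: "('n::{finite,linorder}) form^2^2"
  assumes "CARD('n) \<ge> 4"
    and "griffiths_positive M"
    and "diagonalized_entries M"
  shows "lefschetz (det2 M) (CARD('n) - 2) 0
       \<and> lefschetz (det2 M) (CARD('n) - 3) 1
       \<and> lefschetz (det2 M) 1 (CARD('n) - 3)
       \<and> lefschetz (det2 M) 0 (CARD('n) - 2)"
proof -
  obtain A :: "complex^('n::{finite,linorder})^('n::{finite,linorder})" and b where A: "invertible A"
    and M: "\<And>i j. M $ i $ j = (\<Sum>l\<in>UNIV. fscale (b i j l) (std11 A l))"
    using assms(3) by (auto simp: diagonalized_entries_def)
  obtain Ai where Ai: "A ** Ai = mat 1" "Ai ** A = mat 1"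
    using A by (auto simp: invertible_def)
  \<comment> \<open>The contraction of \<open>M\<close> with (x, y) is Kaehler and diagonal in the
    coordinates \<open>A\<close>; its weight at \<open>l\<close> is the value of the
    \<open>l\<close>-th coefficient matrix at that vector.\<close>
  have "\<exists>r>0. x * cnj x * b 1 1 l + x * cnj y * b 1 2 l + y * cnj x * b 2 1 l + y * cnj y * b 2 2 l
      = complex_of_real r" if "x \<noteq> 0 \<or> y \<noteq> 0" for x y l
  proof -
    define \<theta> :: "complex^2" where "\<theta> = vector [x, y]"
    have \<theta>: "\<theta> $ 1 = x" "\<theta> $ 2 = y" by (simp_all add: \<theta>_def)
    then have "\<theta> \<noteq> 0" using that by auto
    then have "is_kahler (\<Sum>i\<in>UNIV. \<Sum>j\<in>UNIV. fscale (\<theta> $ i * cnj (\<theta> $ j)) (M $ i $ j))"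
      using assms(2) unfolding griffiths_positive_def by blast
    also have "(\<Sum>i\<in>UNIV. \<Sum>j\<in>UNIV. fscale (\<theta> $ i * cnj (\<theta> $ j)) (M $ i $ j)) =
      (\<Sum>l\<in>UNIV. fscale (x * cnj x * b 1 1 l + x * cnj y * b 1 2 l + y * cnj x * b 2 1 l + y * cnj y * b 2 2 l) (std11 A l))"
      by (simp add: sum_2 \<theta> M form.scale_sum_right form.scale_left_distrib sum.distrib add.assoc)
    finally show ?thesis using A by (rule diagonal_kahler_pos)
  qed
  then have "\<exists>p r s t. b 1 1 l = of_real p \<and> b 2 2 l = of_real r \<and> b 1 2 l = Complex s t
      \<and> b 2 1 l = Complex s (- t) \<and> p > 0 \<and> p * r > s\<^sup>2 + t\<^sup>2" for l
    by (rule hermitian_pos_def2)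
  then obtain P R S T where b: "\<And>l. b 1 1 l = of_real (P l)" "\<And>l. b 2 2 l = of_real (R l)"
      "\<And>l. b 1 2 l = Complex (S l) (T l)" "\<And>l. b 2 1 l = Complex (S l) (- T l)"
      "\<And>l. P l > 0" "\<And>l. P l * R l > (S l)\<^sup>2 + (T l)\<^sup>2"
    by metis
  define H where "H l = (P l, R l, S l, T l)" for l
  have H: "fst (H l) > 0" "herm_form (H l) (H l) > 0" for l
    using b(5,6) [of l] by (auto simp: H_def herm_form_def power2_eq_square algebra_simps)
  \<comment> \<open>The determinant of \<open>M\<close> expands with these weights on products of
    two diagonal forms; their symmetrization is the polarized determinant.\<close>
  define g where "g l m = b 1 1 l * b 2 2 m - b 1 2 l * b 2 1 m" for l m
  have c: "g l m + g m l = complex_of_real (herm_form (H l) (H m))" for l m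
    by (simp add: g_def b H_def herm_form_def complex_eq_iff algebra_simps)
  have prod: "wedge (M $ i $ j) (M $ i' $ j') = subst_form (coord A) (\<Sum>l\<in>UNIV. \<Sum>m\<in>UNIV.
      fscale (b i j l * b i' j' m) (wedge (std11 (mat 1) l) (std11 (mat 1) m)))" for i j i' j'
    by (simp only: M std11_subst [of A] flin_sum [OF flin_wedge_left] flin_scale [OF flin_wedge_left])
       (simp add: flin_sum [OF flin_wedge_right] flin_scale [OF flin_wedge_right] form.scale_sum_right
        flin_sum [OF flin_subst_form] flin_scale [OF flin_subst_form] subst_form_wedge [OF anticomm_coord])
  have \<Omega>: "det2 M = subst_form (coord A) (diag22 g)"
    by (simp add: det2_def prod form2.linear_diff [OF flin_subst_form, symmetric] diag22_def g_def
        form.scale_left_diff_distrib sum_subtractf)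
  have MV: "M $ i $ j \<in> Vpq 1 1" for i j
    using assms(2) unfolding griffiths_positive_def by blast
  have \<Omega>V: "det2 M \<in> Vpq 2 2"
    unfolding det2_def by (intro Vpq_diff Vpq_wedge [OF MV MV, unfolded one_add_one])
  \<comment> \<open>These conditions cover all four bidegrees at once.\<close>
  have "lefschetz (det2 M) p q" if pq: "p + q = CARD('n) - 2" "p \<le> 1 \<or> q \<le> 1" for p q
  proof (rule lefschetzI [OF \<Omega>V pq(1)])
    show n2: "2 \<le> CARD('n)" using assms(1) by simp
    fix \<alpha> :: "'n form"
    assume \<alpha>: "\<alpha> \<in> Vpq p q" and 0: "wedge \<alpha> (det2 M) = 0"
    \<comment> \<open>\<open>\<beta>\<close> is \<open>\<alpha>\<close> written in the diagonalizing
      coordinates.\<close>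
    define \<beta> where "\<beta> = subst_form (coord Ai) \<alpha>"
    have \<alpha>\<beta>: "\<alpha> = subst_form (coord A) \<beta>"
      by (simp add: \<beta>_def subst_coord_inverse [OF Ai(2)])
    have \<beta>: "\<beta> \<in> Vpq p q" unfolding \<beta>_def using \<alpha> by (rule subst_coord_Vpq)
    have \<beta>0: "wedge \<beta> (diag22 g) = 0"
    proof -
      have "subst_form (coord A) (wedge \<beta> (diag22 g)) = 0"
        using 0 by (simp add: \<Omega> \<alpha>\<beta> subst_form_wedge [OF anticomm_coord])
      then show ?thesis
        by (metis Ai(1) form2.linear_0 [OF flin_subst_form] subst_coord_inverse)
    qed
    have "\<beta> = 0"
    proof (rule diag22_injective [OF \<beta> pq(1) n2 pq(2) _ _ \<beta>0])
      show "g l m + g m l \<noteq> 0" for l m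
        unfolding c using herm_form_pos [OF H H, of l m] by simp
      fix i j k l :: 'n
      define x y z where "x = herm_form (H i) (H j) * herm_form (H k) (H l)"
        and "y = herm_form (H i) (H k) * herm_form (H j) (H l)" and "z = herm_form (H i) (H l) * herm_form (H j) (H k)"
      \<comment> \<open>The list turns the four indices into a sequence. Beyond position 3 its
        entries are unspecified, but \<open>H\<close> gives positivity at every index.\<close>
      have "x\<^sup>2 + y\<^sup>2 + z\<^sup>2 - 2 * x * y - 2 * y * z - 2 * x * z \<noteq> 0"
        using herm_form_zero_diagonal_det [of "\<lambda>n. H ([i, j, k, l] ! n)"] H by (simp add: x_def y_def z_def)
      then have "complex_of_real (x\<^sup>2 + y\<^sup>2 + z\<^sup>2 - 2 * x * y - 2 * y * z - 2 * x * z) \<noteq> 0"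
        by (simp only: of_real_eq_0_iff not_False_eq_True)
      then show "((g i j + g j i) * (g k l + g l k))\<^sup>2 + ((g i k + g k i) * (g j l + g l j))\<^sup>2
          + ((g i l + g l i) * (g j k + g k j))\<^sup>2
          - 2 * ((g i j + g j i) * (g k l + g l k)) * ((g i k + g k i) * (g j l + g l j))
          - 2 * ((g i k + g k i) * (g j l + g l j)) * ((g i l + g l i) * (g j k + g k j))
          - 2 * ((g i j + g j i) * (g k l + g l k)) * ((g i l + g l i) * (g j k + g k j)) \<noteq> 0"
        by (simp only: c x_def y_def z_def of_real_add of_real_diff of_real_mult of_real_power
            of_real_numeral not_False_eq_True)
    qed
    then show "\<alpha> = 0" by (simp add: \<alpha>\<beta> form2.linear_0 [OF flin_subst_form])
  qed
  then show ?thesis using assms(1) by auto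
qed

end
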